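(* Let $t\ge 1$. The additively idempotent semiring $(R_t,+_{\mathrm{nat}},\cdot)$ admits a finite identity basis if and only if $t=1$.
   Context: $R_t$ is the set of all zero-one $t\times t$-matrices with at most one entry equal to $1$ in each row and each column. The multiplication $\cdot$ is the usual matrix multiplication, and $+_{\mathrm{nat}}$ is the Hadamard (entrywise) product: $(a_{ij})_{t\times t}+_{\mathrm{nat}}(b_{ij})_{t\times t}=(a_{ij}b_{ij})_{t\times t}$. (With transposition as inversion, $(R_t,\cdot,{}^{-1})$ is an inverse monoid, the rook monoid, and $x+_{\mathrm{nat}}y$ is the infimum of $x,y$ in the natural partial order $x\le_{\mathrm{nat}}y\iff x=xx^{-1}y$.) An additively idempotent semiring is an algebra $(S,+,\cdot)$ of type $(2,2)$ such that $(S,+)$ is a commutative idempotent semigroup, $(S,\cdot)$ is a semigroup, and the identities $x(y+z)\approx xy+xz$ and $(y+z)x\approx yx+zx$ hold; $(R_t,+_{\mathrm{nat}},\cdot)$ is such an algebra. A set $\Sigma$ of identities valid in an algebra $\mathcal A$ is an identity basis for $\mathcal A$ if all identities holding in $\mathcal A$ follow from $\Sigma$. Identity bases of additively idempotent semirings are considered in the signature $\{+,\cdot\}$. *)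

theory Defs
  imports "Jordan_Normal_Form.Matrix"
begin

datatype sterm = Var nat | Add sterm sterm | Mul sterm sterm

type_synonym identity = "sterm \<times> sterm"

record 'a algebra22 = "'a partial_object" +
  alg_add :: "'a \<Rightarrow> 'a \<Rightarrow> 'a"
  alg_mul :: "'a \<Rightarrow> 'a \<Rightarrow> 'a"

primrec eval_term :: "('a, 'm) algebra22_scheme \<Rightarrow> (nat \<Rightarrow> 'a) \<Rightarrow> sterm \<Rightarrow> 'a" where
  "eval_term S \<phi> (Var x) = \<phi> x"
| "eval_term S \<phi> (Add u v) = alg_add S (eval_term S \<phi> u) (eval_term S \<phi> v)"
| "eval_term S \<phi> (Mul u v) = alg_mul S (eval_term S \<phi> u) (eval_term S \<phi> v)"

definition holds_in :: "('a, 'm) algebra22_scheme \<Rightarrow> identity \<Rightarrow> bool" where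
  "holds_in S e \<longleftrightarrow>
     (\<forall>\<phi>. (\<forall>x. \<phi> x \<in> carrier S) \<longrightarrow> eval_term S \<phi> (fst e) = eval_term S \<phi> (snd e))"

primrec subst_term :: "(nat \<Rightarrow> sterm) \<Rightarrow> sterm \<Rightarrow> sterm" where
  "subst_term \<sigma> (Var x) = \<sigma> x"
| "subst_term \<sigma> (Add u v) = Add (subst_term \<sigma> u) (subst_term \<sigma> v)"
| "subst_term \<sigma> (Mul u v) = Mul (subst_term \<sigma> u) (subst_term \<sigma> v)"

text \<open>An identity follows from a set of identities if it is derivable from it in equational logic.
  The semiring axioms are not built in: an identity basis has to entail them as well.\<close>

inductive follows :: "identity set \<Rightarrow> sterm \<Rightarrow> sterm \<Rightarrow> bool" for \<Sigma> where
  inst: "(u, v) \<in> \<Sigma> \<Longrightarrow> follows \<Sigma> (subst_term \<sigma> u) (subst_term \<sigma> v)"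
| refl: "follows \<Sigma> u u"
| sym: "follows \<Sigma> u v \<Longrightarrow> follows \<Sigma> v u"
| trans: "follows \<Sigma> u v \<Longrightarrow> follows \<Sigma> v w \<Longrightarrow> follows \<Sigma> u w"
| add: "follows \<Sigma> u u' \<Longrightarrow> follows \<Sigma> v v' \<Longrightarrow> follows \<Sigma> (Add u v) (Add u' v')"
| mul: "follows \<Sigma> u u' \<Longrightarrow> follows \<Sigma> v v' \<Longrightarrow> follows \<Sigma> (Mul u v) (Mul u' v')"

definition identity_basis :: "('a, 'm) algebra22_scheme \<Rightarrow> identity set \<Rightarrow> bool" where
  "identity_basis S \<Sigma> \<longleftrightarrow>
     (\<forall>e\<in>\<Sigma>. holds_in S e) \<and> (\<forall>u v. holds_in S (u, v) \<longrightarrow> follows \<Sigma> u v)"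

definition finitely_based :: "('a, 'm) algebra22_scheme \<Rightarrow> bool" where
  "finitely_based S \<longleftrightarrow> (\<exists>\<Sigma>. finite \<Sigma> \<and> identity_basis S \<Sigma>)"

definition rook_matrices :: "nat \<Rightarrow> int mat set" where
  "rook_matrices t = {A \<in> carrier_mat t t.
     (\<forall>i<t. \<forall>j<t. A $$ (i, j) \<in> {0, 1}) \<and>
     (\<forall>i<t. card {j. j < t \<and> A $$ (i, j) = 1} \<le> 1) \<and>
     (\<forall>j<t. card {i. i < t \<and> A $$ (i, j) = 1} \<le> 1)}"

definition hadamard :: "'a::times mat \<Rightarrow> 'a mat \<Rightarrow> 'a mat" where
  "hadamard A B = mat (dim_row A) (dim_col A) (\<lambda>(i, j). A $$ (i, j) * B $$ (i, j))"

definition rook_semiring :: "nat \<Rightarrow> int mat algebra22" where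
  "rook_semiring t = \<lparr>carrier = rook_matrices t, alg_add = hadamard, alg_mul = (*)\<rparr>"

end

theory Submission
  imports Defs
begin

text \<open>
  Rook matrices are partial injections of \<open>t\<close> points, with intersection as addition and relational
  composition as multiplication; hence a pair of points lies in the value of a term iff every word
  of the term labels a path between them. For \<open>t = 1\<close> both operations coincide and the semiring is
  a semilattice.

  For \<open>t \<ge> 2\<close> consider words \<open>x\<^sub>j y z\<^sub>j\<close> (\<open>0 \<le> j \<le> n\<close>) and \<open>x\<^sub>j\<^sub>+\<^sub>1 y\<^sub>j z\<^sub>j\<close> (\<open>0 \<le> j < n\<close>), where \<open>y\<^sub>j\<close> depends
  only on \<open>j mod D\<close>. If they all lead from \<open>p\<close> to \<open>q\<close> and \<open>s\<^sub>j\<close> is the point reached by \<open>x\<^sub>j\<close>, then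
  injectivity shows that \<open>s\<^sub>i = s\<^sub>j\<close> implies \<open>s\<^sub>i\<^sub>+\<^sub>1 = s\<^sub>j\<^sub>+\<^sub>1\<close> whenever \<open>i\<close> and \<open>j\<close> are congruent modulo
  \<open>D\<close>. Two of the \<open>t + 1\<close> points \<open>s\<^sub>0, s\<^sub>D, \<dots>, s\<^sub>t\<^sub>D\<close> coincide, so the sequence becomes periodic with
  period \<open>d D\<close> for some \<open>d \<le> t\<close>. Thus \<open>s\<^sub>m = s\<^sub>n\<close> for \<open>m = t D\<close>, \<open>n = m + t! D\<close>, and the word \<open>x\<^sub>m y z\<^sub>n\<close>
  leads from \<open>p\<close> to \<open>q\<close> as well.

  The resulting identity fails in the gadget semiring of partial injections of
  \<open>{Src} \<union> {Lft a} \<union> {Rgt a} \<union> {Tgt}\<close> in which all words above lead from \<open>Src\<close> to \<open>Tgt\<close>. An identity in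
  fewer than \<open>D\<close> variables, however, never sees all the residue classes of shifts \<open>y\<^sub>j\<close>. When one class
  is left out, any two points can be distinguished by a 2-colouring that turns all remaining
  relations into partial injections of two colours: colour by level, by the residue modulo \<open>D\<close>, or by
  the blocks between consecutive numbers of the missing class. Hence every such identity valid in the
  rook semiring also holds in the gadget.\<close>

section \<open>Semirings of partial injections\<close>

definition pinj :: "'p rel \<Rightarrow> bool" where
  "pinj R \<longleftrightarrow> single_valued R \<and> single_valued (R\<inverse>)"

definition rel_alg :: "'p rel set \<Rightarrow> 'p rel algebra22" where
  "rel_alg C = \<lparr>carrier = C, alg_add = (\<inter>), alg_mul = (O)\<rparr>"

definition finite_pinj :: "nat \<Rightarrow> nat rel set" where
  "finite_pinj t = {R. R \<subseteq> {..<t} \<times> {..<t} \<and> pinj R}"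

lemma pinjI:
  assumes "\<And>a b c. (a, b) \<in> R \<Longrightarrow> (a, c) \<in> R \<Longrightarrow> b = c"
    and "\<And>a b c. (a, c) \<in> R \<Longrightarrow> (b, c) \<in> R \<Longrightarrow> a = b"
  shows "pinj R"
  using assms unfolding pinj_def single_valued_def by blast

lemma pinj_right: "pinj R \<Longrightarrow> (a, b) \<in> R \<Longrightarrow> (a, c) \<in> R \<Longrightarrow> b = c"
  unfolding pinj_def single_valued_def by blast

lemma pinj_left: "pinj R \<Longrightarrow> (a, c) \<in> R \<Longrightarrow> (b, c) \<in> R \<Longrightarrow> a = b"
  unfolding pinj_def single_valued_def by blast

lemma pinj_empty [simp]: "pinj {}"
  by (rule pinjI) auto

lemma pinj_singleton [simp]: "pinj {e}"
  by (cases e) (rule pinjI; auto)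

lemma pinj_subset: "pinj R \<Longrightarrow> S \<subseteq> R \<Longrightarrow> pinj S"
  by (rule pinjI) (blast dest: pinj_right pinj_left)+

lemma pinj_Id: "R \<subseteq> Id \<Longrightarrow> pinj R"
  by (rule pinjI) auto

lemma pinj_comp: "pinj R \<Longrightarrow> pinj S \<Longrightarrow> pinj (R O S)"
  by (rule pinjI) (blast dest: pinj_right pinj_left)+

lemma rel_alg_simps [simp]:
  "carrier (rel_alg C) = C" "alg_add (rel_alg C) = (\<inter>)" "alg_mul (rel_alg C) = (O)"
  by (simp_all add: rel_alg_def)

section \<open>Terms as sets of words\<close>

primrec vars :: "sterm \<Rightarrow> nat set" where
  "vars (Var x) = {x}"
| "vars (Add u v) = vars u \<union> vars v"
| "vars (Mul u v) = vars u \<union> vars v"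

primrec words :: "sterm \<Rightarrow> nat list set" where
  "words (Var x) = {[x]}"
| "words (Add u v) = words u \<union> words v"
| "words (Mul u v) = {w @ w' | w w'. w \<in> words u \<and> w' \<in> words v}"

primrec run :: "(nat \<Rightarrow> 'p rel) \<Rightarrow> nat list \<Rightarrow> 'p rel" where
  "run \<phi> [] = Id"
| "run \<phi> (x # w) = \<phi> x O run \<phi> w"

lemma finite_vars: "finite (vars u)"
  by (induction u) auto

lemma words_nonempty: "words u \<noteq> {}"
  by (induction u) auto

lemma run_append: "run \<phi> (w @ w') = run \<phi> w O run \<phi> w'"
  by (induction w) auto

lemma pinj_run: "(\<And>x. pinj (\<phi> x)) \<Longrightarrow> pinj (run \<phi> w)"
  by (induction w) (auto intro: pinj_comp pinj_Id)

text \<open>In a product, one pair of words fixes the intermediate point. As runs are partial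
  injections, all other words of both factors pass through the same point, so composition
  distributes over intersection.\<close>

lemma eval_term_rel:
  assumes "\<And>x. pinj (\<phi> x)"
  shows "(p, q) \<in> eval_term (rel_alg C) \<phi> u \<longleftrightarrow> (\<forall>w\<in>words u. (p, q) \<in> run \<phi> w)"
proof (induction u arbitrary: p q)
  case (Mul u v)
  have "\<exists>m. (\<forall>w\<in>words u. (p, m) \<in> run \<phi> w) \<and> (\<forall>w\<in>words v. (m, q) \<in> run \<phi> w)"
    if *: "\<forall>w\<in>words (Mul u v). (p, q) \<in> run \<phi> w"
  proof -
    have **: "(p, q) \<in> run \<phi> w O run \<phi> w'" if "w \<in> words u" "w' \<in> words v" for w w'
      using * that by (force simp flip: run_append)
    obtain w0 w1 where w: "w0 \<in> words u" "w1 \<in> words v"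
      using words_nonempty by (metis all_not_in_conv)
    then obtain m where m: "(p, m) \<in> run \<phi> w0" "(m, q) \<in> run \<phi> w1"
      using ** by blast
    have "(p, m) \<in> run \<phi> w" if "w \<in> words u" for w
      using **[OF that w(2)] m(2) pinj_left[OF pinj_run[of \<phi>, OF assms]] by blast
    moreover have "(m, q) \<in> run \<phi> w" if "w \<in> words v" for w
      using **[OF w(1) that] m(1) pinj_right[OF pinj_run[of \<phi>, OF assms]] by blast
    ultimately show ?thesis by blast
  qed
  then show ?case
    using Mul.IH by (auto simp: relcomp.simps run_append) metis
qed auto

lemma eval_term_cong:
  "(\<And>x. x \<in> vars u \<Longrightarrow> \<phi> x = \<psi> x) \<Longrightarrow> eval_term S \<phi> u = eval_term S \<psi> u"
  by (induction u) auto

section \<open>The rook semiring as a semiring of partial injections\<close>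

definition supp :: "int mat \<Rightarrow> nat rel" where
  "supp A = {(i, j). i < dim_row A \<and> j < dim_col A \<and> A $$ (i, j) = 1}"

definition rel_mat :: "nat \<Rightarrow> nat rel \<Rightarrow> int mat" where
  "rel_mat t R = mat t t (\<lambda>e. if e \<in> R then 1 else 0)"

text \<open>The row bounds express that the support is single-valued, the column bounds that its
  converse is.\<close>

lemma rook_matrices_iff:
  "A \<in> rook_matrices t \<longleftrightarrow>
     A \<in> carrier_mat t t \<and> (\<forall>i<t. \<forall>j<t. A $$ (i, j) \<in> {0, 1}) \<and> pinj (supp A)"
proof -
  have "pinj (supp A) \<longleftrightarrow>
      (\<forall>i<t. card {j. j < t \<and> A $$ (i, j) = 1} \<le> 1) \<and>
      (\<forall>j<t. card {i. i < t \<and> A $$ (i, j) = 1} \<le> 1)" if "A \<in> carrier_mat t t"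
    using that by (auto simp: pinj_def single_valued_def supp_def card_le_Suc0_iff_eq)
  then show ?thesis
    unfolding rook_matrices_def by blast
qed

lemma supp_rook: "A \<in> rook_matrices t \<Longrightarrow> supp A \<in> finite_pinj t"
  by (auto simp: rook_matrices_iff finite_pinj_def supp_def)

lemma supp_rel_mat: "R \<in> finite_pinj t \<Longrightarrow> supp (rel_mat t R) = R"
  by (auto simp: finite_pinj_def supp_def rel_mat_def split: if_splits)

lemma rel_mat_rook: "R \<in> finite_pinj t \<Longrightarrow> rel_mat t R \<in> rook_matrices t"
  using supp_rel_mat[of R t]
  by (auto simp: rook_matrices_iff finite_pinj_def) (auto simp: rel_mat_def)

lemma rook_entry:
  assumes "A \<in> rook_matrices t" "i < t" "j < t"
  shows "A $$ (i, j) = (if (i, j) \<in> supp A then 1 else 0)"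
proof -
  have "dim_row A = t" "dim_col A = t" "A $$ (i, j) \<in> {0, 1}"
    using assms by (auto simp: rook_matrices_iff)
  then show ?thesis using assms(2,3) by (auto simp: supp_def)
qed

lemma rel_mat_supp:
  assumes "A \<in> rook_matrices t" shows "rel_mat t (supp A) = A"
  using assms by (intro eq_matI) (auto simp: rook_entry rook_matrices_iff rel_mat_def)

lemma finite_pinj_closed:
  assumes "R \<in> finite_pinj t" "S \<in> finite_pinj t"
  shows "R \<inter> S \<in> finite_pinj t" "R O S \<in> finite_pinj t"
  using assms pinj_comp[of R S] pinj_subset[of R "R \<inter> S"] by (auto simp: finite_pinj_def)

lemma hadamard_rel_mat:
  assumes "A \<in> rook_matrices t" "B \<in> rook_matrices t"
  shows "hadamard A B = rel_mat t (supp A \<inter> supp B)"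
proof (rule eq_matI)
  fix i j assume "i < dim_row (rel_mat t (supp A \<inter> supp B))" "j < dim_col (rel_mat t (supp A \<inter> supp B))"
  then have "i < t" "j < t" by (simp_all add: rel_mat_def)
  moreover have "A \<in> carrier_mat t t" using assms by (simp add: rook_matrices_iff)
  ultimately show "hadamard A B $$ (i, j) = rel_mat t (supp A \<inter> supp B) $$ (i, j)"
    by (simp add: hadamard_def rel_mat_def rook_entry[OF assms(1)] rook_entry[OF assms(2)])
qed (use assms in \<open>auto simp: rook_matrices_iff rel_mat_def hadamard_def\<close>)

lemma mult_rel_mat:
  assumes A: "A \<in> rook_matrices t" and B: "B \<in> rook_matrices t"
  shows "A * B = rel_mat t (supp A O supp B)"
proof (rule eq_matI)
  fix i j assume "i < dim_row (rel_mat t (supp A O supp B))" "j < dim_col (rel_mat t (supp A O supp B))"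
  then have ij: "i < t" "j < t" by (simp_all add: rel_mat_def)
  have carr: "A \<in> carrier_mat t t" "B \<in> carrier_mat t t"
    using A B by (auto simp: rook_matrices_iff)
  note entry = rook_entry[OF A ij(1)] rook_entry[OF B _ ij(2)]
  have "(A * B) $$ (i, j) = (\<Sum>k = 0..<t. A $$ (i, k) * B $$ (k, j))"
    using carr ij by (auto simp: scalar_prod_def intro!: sum.cong)
  also have "\<dots> = (if (i, j) \<in> supp A O supp B then 1 else 0)"
  proof (cases "(i, j) \<in> supp A O supp B")
    case True
    then obtain m where m: "(i, m) \<in> supp A" "(m, j) \<in> supp B" by blast
    have "m < t" using m(1) carr by (auto simp: supp_def)
    have "A $$ (i, k) * B $$ (k, j) = (if k = m then 1 else 0)" if "k < t" for k
    proof (cases "k = m")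
      case True
      then show ?thesis using entry[OF that] m by simp
    next
      case False
      then have "(i, k) \<notin> supp A"
        using pinj_right[of "supp A" i k m] m A by (auto simp: rook_matrices_iff)
      then show ?thesis using entry[OF that] False by simp
    qed
    then have "(\<Sum>k = 0..<t. A $$ (i, k) * B $$ (k, j)) = (\<Sum>k = 0..<t. if k = m then 1 else 0)"
      by (intro sum.cong) auto
    then show ?thesis using \<open>m < t\<close> True by simp
  next
    case False
    then have "A $$ (i, k) * B $$ (k, j) = 0" if "k < t" for k
      using entry[OF that] by auto
    then have "(\<Sum>k = 0..<t. A $$ (i, k) * B $$ (k, j)) = 0"
      by (meson atLeastLessThan_iff sum.neutral)
    then show ?thesis using False by simp
  qed
  also have "\<dots> = rel_mat t (supp A O supp B) $$ (i, j)"
    using ij by (simp add: rel_mat_def)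
  finally show "(A * B) $$ (i, j) = rel_mat t (supp A O supp B) $$ (i, j)" .
qed (use A B in \<open>auto simp: rook_matrices_iff rel_mat_def\<close>)

lemma rook_semiring_simps [simp]:
  "carrier (rook_semiring t) = rook_matrices t"
  "alg_add (rook_semiring t) = hadamard" "alg_mul (rook_semiring t) = (*)"
  by (simp_all add: rook_semiring_def)

lemma eval_rook:
  assumes "\<And>x. \<phi> x \<in> rook_matrices t"
  shows "eval_term (rook_semiring t) \<phi> u \<in> rook_matrices t \<and>
    supp (eval_term (rook_semiring t) \<phi> u) = eval_term (rel_alg (finite_pinj t)) (supp \<circ> \<phi>) u"
proof (induction u)
  case (Var x)
  then show ?case using assms by simp
next
  case (Add u v)
  let ?A = "eval_term (rook_semiring t) \<phi> u" and ?B = "eval_term (rook_semiring t) \<phi> v"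
  have "supp ?A \<inter> supp ?B \<in> finite_pinj t"
    using Add.IH by (intro finite_pinj_closed supp_rook) blast+
  then show ?case
    using Add.IH by (simp add: hadamard_rel_mat[of _ t] rel_mat_rook supp_rel_mat)
next
  case (Mul u v)
  let ?A = "eval_term (rook_semiring t) \<phi> u" and ?B = "eval_term (rook_semiring t) \<phi> v"
  have "supp ?A O supp ?B \<in> finite_pinj t"
    using Mul.IH by (intro finite_pinj_closed supp_rook) blast+
  then show ?case
    using Mul.IH by (simp add: mult_rel_mat[of _ t] rel_mat_rook supp_rel_mat)
qed

text \<open>\<open>supp\<close> and \<open>rel_mat t\<close> are mutually inverse between the two
  carriers, so valuations can be carried over in both directions.\<close>

lemma holds_in_rook:
  "holds_in (rook_semiring t) e \<longleftrightarrow> holds_in (rel_alg (finite_pinj t)) e"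
proof
  assume L: "holds_in (rook_semiring t) e"
  show "holds_in (rel_alg (finite_pinj t)) e"
    unfolding holds_in_def
  proof (intro allI impI)
    fix \<phi> :: "nat \<Rightarrow> nat rel" assume "\<forall>x. \<phi> x \<in> carrier (rel_alg (finite_pinj t))"
    then have \<phi>: "\<phi> x \<in> finite_pinj t" for x by simp
    let ?\<psi> = "\<lambda>x. rel_mat t (\<phi> x)"
    have \<psi>: "?\<psi> x \<in> rook_matrices t" for x
      using \<phi> by (rule rel_mat_rook)
    have "eval_term (rook_semiring t) ?\<psi> (fst e) = eval_term (rook_semiring t) ?\<psi> (snd e)"
      using L \<psi> by (simp add: holds_in_def)
    moreover have "supp \<circ> ?\<psi> = \<phi>"
      using \<phi> by (auto simp: supp_rel_mat)
    ultimately show "eval_term (rel_alg (finite_pinj t)) \<phi> (fst e) =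
        eval_term (rel_alg (finite_pinj t)) \<phi> (snd e)"
      using eval_rook[of ?\<psi>, OF \<psi>] by metis
  qed
next
  assume R: "holds_in (rel_alg (finite_pinj t)) e"
  show "holds_in (rook_semiring t) e"
    unfolding holds_in_def
  proof (intro allI impI)
    fix \<phi> :: "nat \<Rightarrow> int mat" assume "\<forall>x. \<phi> x \<in> carrier (rook_semiring t)"
    then have \<phi>: "\<phi> x \<in> rook_matrices t" for x by simp
    have "eval_term (rel_alg (finite_pinj t)) (supp \<circ> \<phi>) (fst e) =
        eval_term (rel_alg (finite_pinj t)) (supp \<circ> \<phi>) (snd e)"
      using R \<phi> by (simp add: holds_in_def supp_rook)
    then show "eval_term (rook_semiring t) \<phi> (fst e) = eval_term (rook_semiring t) \<phi> (snd e)"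
      using eval_rook[of \<phi>, OF \<phi>] rel_mat_supp by metis
  qed
qed

section \<open>The case of one point\<close>

text \<open>The first identity rewrites sums as products; with the semilattice laws for
  multiplication it entails the semiring axioms as well.\<close>

definition semilattice_basis :: "identity set" where
  "semilattice_basis =
    {(Add (Var 0) (Var 1), Mul (Var 0) (Var 1)),
     (Mul (Var 0) (Var 1), Mul (Var 1) (Var 0)),
     (Mul (Mul (Var 0) (Var 1)) (Var 2), Mul (Var 0) (Mul (Var 1) (Var 2))),
     (Mul (Var 0) (Var 0), Var 0)}"

abbreviation semilattice_eq :: "sterm \<Rightarrow> sterm \<Rightarrow> bool" (infix "\<approx>" 50) where
  "u \<approx> v \<equiv> follows semilattice_basis u v"

lemmas [trans] = follows.trans

lemma semilattice_laws:
  "Add u v \<approx> Mul u v" "Mul u v \<approx> Mul v u" "Mul (Mul u v) w \<approx> Mul u (Mul v w)" "Mul u u \<approx> u"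
proof -
  let ?\<sigma> = "\<lambda>x::nat. if x = 0 then u else if x = 1 then v else w"
  note inst = follows.inst[of _ _ semilattice_basis ?\<sigma>]
  show "Add u v \<approx> Mul u v"
    using inst[of "Add (Var 0) (Var 1)" "Mul (Var 0) (Var 1)"] by (simp add: semilattice_basis_def)
  show "Mul u v \<approx> Mul v u"
    using inst[of "Mul (Var 0) (Var 1)" "Mul (Var 1) (Var 0)"] by (simp add: semilattice_basis_def)
  show "Mul (Mul u v) w \<approx> Mul u (Mul v w)"
    using inst[of "Mul (Mul (Var 0) (Var 1)) (Var 2)" "Mul (Var 0) (Mul (Var 1) (Var 2))"]
    by (simp add: semilattice_basis_def)
  show "Mul u u \<approx> u"
    using inst[of "Mul (Var 0) (Var 0)" "Var 0"] by (simp add: semilattice_basis_def)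
qed

text \<open>Sums are rewritten as products, and commutativity moves a factor containing
  \<open>x\<close> next to \<open>Var x\<close>, where the induction hypothesis absorbs it.\<close>

lemma absorb_var: "x \<in> vars u \<Longrightarrow> Mul u (Var x) \<approx> u"
proof (induction u)
  case (Var y)
  then show ?case by (simp add: semilattice_laws)
next
  case (Mul u v)
  show ?case
  proof (cases "x \<in> vars v")
    case True
    have "Mul (Mul u v) (Var x) \<approx> Mul u (Mul v (Var x))" by (rule semilattice_laws)
    also have "\<dots> \<approx> Mul u v" using Mul.IH(2)[OF True] by (intro follows.mul follows.refl)
    finally show ?thesis .
  next
    case False
    have "Mul (Mul u v) (Var x) \<approx> Mul (Mul v u) (Var x)"
      by (intro follows.mul follows.refl semilattice_laws)
    also have "\<dots> \<approx> Mul v (Mul u (Var x))" by (rule semilattice_laws)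
    also have "\<dots> \<approx> Mul v u" using Mul False by (intro follows.mul follows.refl) auto
    also have "\<dots> \<approx> Mul u v" by (rule semilattice_laws)
    finally show ?thesis .
  qed
next
  case (Add u v)
  have "Mul (Add u v) (Var x) \<approx> Mul (Mul u v) (Var x)"
    by (intro follows.mul follows.refl semilattice_laws)
  also have "\<dots> \<approx> Mul u v"
  proof (cases "x \<in> vars v")
    case True
    have "Mul (Mul u v) (Var x) \<approx> Mul u (Mul v (Var x))" by (rule semilattice_laws)
    also have "\<dots> \<approx> Mul u v" using Add.IH(2)[OF True] by (intro follows.mul follows.refl)
    finally show ?thesis .
  next
    case False
    have "Mul (Mul u v) (Var x) \<approx> Mul (Mul v u) (Var x)"
      by (intro follows.mul follows.refl semilattice_laws)
    also have "\<dots> \<approx> Mul v (Mul u (Var x))" by (rule semilattice_laws)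
    also have "\<dots> \<approx> Mul v u" using Add False by (intro follows.mul follows.refl) auto
    also have "\<dots> \<approx> Mul u v" by (rule semilattice_laws)
    finally show ?thesis .
  qed
  also have "\<dots> \<approx> Add u v" by (intro follows.sym[OF semilattice_laws(1)])
  finally show ?case .
qed

lemma absorb_term: "vars v \<subseteq> vars u \<Longrightarrow> Mul u v \<approx> u"
proof (induction v)
  case (Var x)
  then show ?case by (simp add: absorb_var)
next
  case (Mul v w)
  have "Mul u (Mul v w) \<approx> Mul (Mul u v) w" by (rule follows.sym[OF semilattice_laws(3)])
  also have "\<dots> \<approx> Mul u w" using Mul by (intro follows.mul follows.refl) auto
  also have "\<dots> \<approx> u" using Mul by simp
  finally show ?case .
next
  case (Add v w)
  have "Mul u (Add v w) \<approx> Mul u (Mul v w)" by (intro follows.mul follows.refl semilattice_laws)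
  also have "\<dots> \<approx> Mul (Mul u v) w" by (rule follows.sym[OF semilattice_laws(3)])
  also have "\<dots> \<approx> Mul u w" using Add by (intro follows.mul follows.refl) auto
  also have "\<dots> \<approx> u" using Add by simp
  finally show ?case .
qed

text \<open>Each term absorbs the other, so both are equal to their product.\<close>

lemma follows_if_vars_eq:
  assumes "vars u = vars v" shows "u \<approx> v"
proof -
  have "u \<approx> Mul u v" using assms by (intro follows.sym[OF absorb_term]) simp
  also have "\<dots> \<approx> Mul v u" by (rule semilattice_laws)
  also have "\<dots> \<approx> v" using assms by (intro absorb_term) simp
  finally show ?thesis .
qed

lemma finite_pinj_1: "R \<in> finite_pinj (Suc 0) \<longleftrightarrow> R = {} \<or> R = {(0, 0)}"
proof -
  have "{..<Suc 0} \<times> {..<Suc 0} = {(0, 0)}" by auto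
  then show ?thesis
    unfolding finite_pinj_def mem_Collect_eq using subset_singleton_iff pinj_empty pinj_singleton by metis
qed

lemma eval_finite_pinj_1:
  assumes "\<And>x. \<phi> x \<in> finite_pinj (Suc 0)"
  shows "eval_term (rel_alg C) \<phi> u = (if \<exists>x\<in>vars u. \<phi> x = {} then {} else {(0, 0)})"
proof (induction u)
  case (Var x)
  then show ?case using assms[of x] by (auto simp: finite_pinj_1)
next
  case (Add u v)
  then show ?case by (simp add: bex_Un)
next
  case (Mul u v)
  then show ?case by (simp add: bex_Un relcomp_unfold)
qed

lemma holds_in_1_iff: "holds_in (rel_alg (finite_pinj (Suc 0))) (u, v) \<longleftrightarrow> vars u = vars v"
proof
  show "holds_in (rel_alg (finite_pinj (Suc 0))) (u, v)" if "vars u = vars v"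
    using that by (simp add: holds_in_def eval_finite_pinj_1)
  show "vars u = vars v" if holds: "holds_in (rel_alg (finite_pinj (Suc 0))) (u, v)"
  proof -
    have "x \<in> vars u \<longleftrightarrow> x \<in> vars v" for x
    proof -
      let ?\<phi> = "\<lambda>y. if y = x then {} else {(0::nat, 0::nat)}"
      let ?eval = "eval_term (rel_alg (finite_pinj (Suc 0))) ?\<phi>"
      have \<phi>: "?\<phi> y \<in> finite_pinj (Suc 0)" for y by (simp add: finite_pinj_1)
      have "?eval w = {} \<longleftrightarrow> x \<in> vars w" for w
        by (subst eval_finite_pinj_1[OF \<phi>]) auto
      moreover have "?eval u = ?eval v"
        using holds \<phi> by (simp add: holds_in_def)
      ultimately show ?thesis by metis
    qed
    then show ?thesis by blast
  qed
qed

lemma finitely_based_1: "finitely_based (rook_semiring 1)"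
proof -
  have "identity_basis (rook_semiring 1) semilattice_basis"
    unfolding identity_basis_def holds_in_rook One_nat_def
    using follows_if_vars_eq holds_in_1_iff by (auto simp: semilattice_basis_def)
  moreover have "finite semilattice_basis" by (simp add: semilattice_basis_def)
  ultimately show ?thesis unfolding finitely_based_def by blast
qed

section \<open>The gadget semirings\<close>

text \<open>In the intended valuation \<open>x\<^sub>a\<close> leads from \<open>Src\<close> to
  \<open>Lft a\<close>, and \<open>z\<^sub>a\<close> from \<open>Rgt a\<close> to
  \<open>Tgt\<close>.\<close>

datatype point = Src | Lft nat | Rgt nat | Tgt

primrec level :: "point \<Rightarrow> nat" where
  "level Src = 0"
| "level (Lft a) = 1"
| "level (Rgt a) = 2"
| "level Tgt = 3"

definition ident_rel :: "point rel" where
  "ident_rel = range (\<lambda>a. (Lft a, Rgt a))"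

definition shift_rel :: "nat set \<Rightarrow> point rel" where
  "shift_rel B = (\<lambda>b. (Lft (Suc b), Rgt b)) ` B"

definition gadget :: "nat \<Rightarrow> point rel set" where
  "gadget D = {{(\<alpha>, \<beta>)} | \<alpha> \<beta>. level \<alpha> < level \<beta>} \<union> {ident_rel} \<union>
     {shift_rel B | B m. \<forall>b\<in>B. b mod D = m}"

lemma gadget_cases [consumes 1, case_names single ident shift]:
  assumes "R \<in> gadget D"
  obtains \<alpha> \<beta> where "R = {(\<alpha>, \<beta>)}" "level \<alpha> < level \<beta>"
    | "R = ident_rel"
    | B m where "R = shift_rel B" "\<And>b. b \<in> B \<Longrightarrow> b mod D = m"
  using assms unfolding gadget_def by blast

lemma gadget_single: "level \<alpha> < level \<beta> \<Longrightarrow> {(\<alpha>, \<beta>)} \<in> gadget D"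
  unfolding gadget_def by blast

lemma gadget_ident: "ident_rel \<in> gadget D"
  unfolding gadget_def by blast

lemma gadget_shift: "(\<And>b. b \<in> B \<Longrightarrow> b mod D = m) \<Longrightarrow> shift_rel B \<in> gadget D"
  unfolding gadget_def by blast

lemma gadget_empty: "{} \<in> gadget D"
  using gadget_shift[of "{}" D] by (simp add: shift_rel_def)

lemma gadget_subsingle: "R \<subseteq> {(\<alpha>, \<beta>)} \<Longrightarrow> level \<alpha> < level \<beta> \<Longrightarrow> R \<in> gadget D"
  by (auto dest: subset_singletonD simp: gadget_empty gadget_single)

lemma pinj_gadget: "R \<in> gadget D \<Longrightarrow> pinj R"
  by (cases rule: gadget_cases) (auto intro!: pinjI simp: ident_rel_def shift_rel_def)

lemma level_less_gadget: "R \<in> gadget D \<Longrightarrow> (\<alpha>, \<beta>) \<in> R \<Longrightarrow> level \<alpha> < level \<beta>"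
  by (cases rule: gadget_cases) (auto simp: ident_rel_def shift_rel_def)

lemma level_le_3: "level \<alpha> \<le> 3"
  by (cases \<alpha>) auto

lemma mem_shift_rel [simp]: "(Lft a, Rgt b) \<in> shift_rel B \<longleftrightarrow> a = Suc b \<and> b \<in> B"
  by (auto simp: shift_rel_def)

lemma gadget_subset:
  assumes "R \<in> gadget D" "R \<noteq> ident_rel" "T \<subseteq> R"
  shows "T \<in> gadget D"
  using assms(1)
proof (cases rule: gadget_cases)
  case (single \<alpha> \<beta>)
  then show ?thesis using assms(3) by (intro gadget_subsingle) auto
next
  case ident
  then show ?thesis using assms(2) by simp
next
  case (shift B m)
  have "T = shift_rel {b \<in> B. (Lft (Suc b), Rgt b) \<in> T}"
    using assms(3) shift(1) by (auto simp: shift_rel_def)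
  then show ?thesis
    using gadget_shift[of "{b \<in> B. (Lft (Suc b), Rgt b) \<in> T}" D m] shift(2) by simp
qed

lemma gadget_Int:
  assumes "R \<in> gadget D" "S \<in> gadget D"
  shows "R \<inter> S \<in> gadget D"
proof (cases "R = ident_rel \<and> S = ident_rel")
  case True
  then show ?thesis by (simp add: gadget_ident)
next
  case False
  then show ?thesis
    using gadget_subset[of R D "R \<inter> S"] gadget_subset[of S D "R \<inter> S"] assms by blast
qed

lemma gadget_levels:
  assumes "R \<in> gadget D" "\<nexists>e. R = {e}" "(x, y) \<in> R"
  shows "level x = 1 \<and> level y = 2"
  using assms by (cases rule: gadget_cases) (auto simp: ident_rel_def shift_rel_def)

text \<open>Members that are not singletons lead from level 1 to level 2, so two of them never
  compose. A nonempty product thus has a singleton factor, and injectivity makes it a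
  singleton.\<close>

lemma gadget_relcomp:
  assumes R: "R \<in> gadget D" and S: "S \<in> gadget D"
  shows "R O S \<in> gadget D"
proof (cases "R O S = {}")
  case False
  then obtain \<alpha> \<beta> \<gamma> where e: "(\<alpha>, \<gamma>) \<in> R" "(\<gamma>, \<beta>) \<in> S" by auto
  have pinj: "pinj (R O S)" using R S by (intro pinj_comp pinj_gadget)
  have "R O S \<subseteq> {(\<alpha>, \<beta>)}"
  proof (cases "\<exists>e. R = {e}")
    case True
    then have "R = {(\<alpha>, \<gamma>)}" using e(1) by auto
    then have "R O S = {\<alpha>} \<times> S `` {\<gamma>}" by auto
    then show ?thesis
      using pinj_right[OF pinj_gadget[OF S] e(2)] by auto
  next
    case False
    then have "level \<gamma> = 2" using gadget_levels[OF R _ e(1)] by simp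
    then have "\<exists>e. S = {e}" using gadget_levels[OF S _ e(2)] by fastforce
    then have "S = {(\<gamma>, \<beta>)}" using e(2) by auto
    then have "R O S = R\<inverse> `` {\<gamma>} \<times> {\<beta>}" by auto
    then show ?thesis
      using pinj_left[OF pinj_gadget[OF R] e(1)] by auto
  qed
  moreover have "level \<alpha> < level \<beta>"
    using level_less_gadget[OF R e(1)] level_less_gadget[OF S e(2)] by simp
  ultimately show ?thesis by (rule gadget_subsingle)
qed (simp add: gadget_empty)

text \<open>A shift relation may also arise as one of the singletons of the gadget, so its residue
  class has to be recovered from the relation itself.\<close>

lemma shift_rel_gadgetD:
  assumes "shift_rel B \<in> gadget D" "b \<in> B" "b' \<in> B"
  shows "b mod D = b' mod D"
  using assms(1)
proof (cases rule: gadget_cases)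
  case (shift B' m)
  then have "B \<subseteq> B'" using mem_shift_rel by blast
  then show ?thesis using shift(2) assms(2,3) by blast
next
  case (single \<alpha> \<beta>)
  then have "(Lft (Suc b), Rgt b) = (\<alpha>, \<beta>)" "(Lft (Suc b'), Rgt b') = (\<alpha>, \<beta>)"
    using assms(2,3) mem_shift_rel by blast+
  then show ?thesis by auto
next
  case ident
  then have "(Lft 0, Rgt 0) \<in> shift_rel B" by (auto simp: ident_rel_def)
  then show ?thesis by simp
qed

section \<open>Separation by two colours\<close>

text \<open>\<open>\<R>\<close> stands for the values of a valuation, \<open>r\<close> for a residue
  class of shifts that none of them uses.\<close>

locale gadget_part =
  fixes D r :: nat and \<R> :: "point rel set"
  assumes r_less: "r < D"
    and sub_gadget: "\<R> \<subseteq> gadget D"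
    and avoid: "\<And>B b. shift_rel B \<in> \<R> \<Longrightarrow> b \<in> B \<Longrightarrow> b mod D \<noteq> r"
begin

text \<open>These turn a valuation in \<open>\<R>\<close> into one by partial injections of the
  points 0 and 1, hence into one in \<open>finite_pinj t\<close> for every \<open>t\<close> \<ge>
  2.\<close>

definition colourings :: "(point \<Rightarrow> nat) set" where
  "colourings = {h. (\<forall>x. h x < 2) \<and> (\<forall>R\<in>\<R>. pinj (map_prod h h ` R))}"

lemma colouringsI:
  assumes "\<And>x. h x < 2" "pinj (map_prod h h ` ident_rel)"
    and "\<And>B m. (\<And>b. b \<in> B \<Longrightarrow> b mod D = m) \<Longrightarrow> (\<And>b. b \<in> B \<Longrightarrow> b mod D \<noteq> r) \<Longrightarrow>
      pinj (map_prod h h ` shift_rel B)"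
  shows "h \<in> colourings"
proof -
  have "pinj (map_prod h h ` R)" if "R \<in> \<R>" for R
  proof -
    have "R \<in> gadget D" using that sub_gadget by blast
    then show ?thesis
    proof (cases rule: gadget_cases)
      case (shift B m)
      then show ?thesis using assms(3)[of B m] avoid[of B] that by simp
    qed (use assms(2) in auto)
  qed
  then show ?thesis using assms(1) by (simp add: colourings_def)
qed

section \<open>Colouring by level, by residue and by block\<close>

definition level_colour :: "nat \<Rightarrow> point \<Rightarrow> nat" where
  "level_colour k x = (if k \<le> level x then 1 else 0)"

lemma level_colour_eq_iff:
  "level_colour k x = level_colour k y \<longleftrightarrow> (k \<le> level x \<longleftrightarrow> k \<le> level y)"
  by (simp add: level_colour_def)

text \<open>All points \<open>Lft a\<close> share a colour, and so do all points
  \<open>Rgt a\<close>; hence the image of \<open>ident_rel\<close> or of a shift relation has at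
  most one pair.\<close>

lemma level_colour: "level_colour k \<in> colourings"
proof (rule colouringsI)
  let ?e = "(level_colour k (Lft 0), level_colour k (Rgt 0))"
  show "pinj (map_prod (level_colour k) (level_colour k) ` ident_rel)"
    by (rule pinj_subset[OF pinj_singleton[of ?e]]) (auto simp: ident_rel_def level_colour_def)
  show "pinj (map_prod (level_colour k) (level_colour k) ` shift_rel B)" for B
    by (rule pinj_subset[OF pinj_singleton[of ?e]]) (auto simp: shift_rel_def level_colour_def)
qed (simp add: level_colour_def)

primrec index_colour :: "(nat \<Rightarrow> nat) \<Rightarrow> point \<Rightarrow> nat" where
  "index_colour s Src = 0"
| "index_colour s (Lft a) = s a"
| "index_colour s (Rgt a) = s a"
| "index_colour s Tgt = 0"

lemma image_ident: "map_prod (index_colour s) (index_colour s) ` ident_rel \<subseteq> Id"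
  by (auto simp: ident_rel_def)

lemma image_shift:
  "map_prod (index_colour s) (index_colour s) ` shift_rel B = (\<lambda>b. (s (Suc b), s b)) ` B"
  by (force simp: shift_rel_def)

lemma index_colour_less: "(\<And>a. s a < 2) \<Longrightarrow> index_colour s x < 2"
  by (cases x) auto

definition residue_colour :: "nat \<Rightarrow> nat \<Rightarrow> nat" where
  "residue_colour m a = (if a mod D = m then 1 else 0)"

text \<open>Equal indices have equal colours, so \<open>ident_rel\<close> goes into the identity. A
  shift relation lies in one class, so its image has at most one pair.\<close>

lemma residue_colour: "index_colour (residue_colour m) \<in> colourings"
proof (rule colouringsI)
  show "index_colour (residue_colour m) x < 2" for x
    by (rule index_colour_less) (simp add: residue_colour_def)
  show "pinj (map_prod (index_colour (residue_colour m)) (index_colour (residue_colour m)) ` ident_rel)"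
    by (intro pinj_Id image_ident)
  show "pinj (map_prod (index_colour (residue_colour m)) (index_colour (residue_colour m)) ` shift_rel B)"
    if "\<And>b. b \<in> B \<Longrightarrow> b mod D = m'" for B m'
  proof (rule pinj_subset[OF pinj_singleton])
    have "Suc b mod D = Suc m' mod D" if "b \<in> B" for b
      using \<open>\<And>b. b \<in> B \<Longrightarrow> b mod D = m'\<close>[OF that] mod_Suc_eq by metis
    then show "map_prod (index_colour (residue_colour m)) (index_colour (residue_colour m)) ` shift_rel B
        \<subseteq> {(if Suc m' mod D = m then 1 else 0, if m' = m then 1 else 0)}"
      unfolding image_shift using that by (auto simp: residue_colour_def)
  qed
qed

text \<open>The blocks are the maximal intervals that contain no two consecutive numbers
  \<open>b\<close>, \<open>Suc b\<close> with \<open>b\<close> in the avoided residue class.\<close>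

definition block :: "nat \<Rightarrow> nat" where
  "block a = (a + (D - Suc r)) div D"

definition block_colour :: "nat \<Rightarrow> nat \<Rightarrow> nat" where
  "block_colour k a = (if block a = k then 1 else 0)"

text \<open>The quotient defining \<open>block\<close> grows from \<open>b\<close> to
  \<open>Suc b\<close> only if \<open>D\<close> divides \<open>b + (D - r)\<close>, that is, if
  \<open>b\<close> lies in class \<open>r\<close>.\<close>

lemma block_Suc:
  assumes "b mod D \<noteq> r" shows "block (Suc b) = block b"
proof -
  have "(b mod D + (D - r)) mod D \<noteq> 0"
  proof (cases "b mod D < r")
    case True
    then show ?thesis using r_less by simp
  next
    case False
    then have "b mod D + (D - r) = (b mod D - r) + D" using r_less by simp
    moreover have "b mod D - r < D" using r_less by (simp add: less_imp_diff_less)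
    ultimately have "(b mod D + (D - r)) mod D = b mod D - r" by simp
    then show ?thesis using False assms by simp
  qed
  then have "(b + (D - r)) mod D \<noteq> 0" by (simp add: mod_add_left_eq)
  moreover have "b + (D - r) = Suc (b + (D - Suc r))" using r_less by simp
  ultimately have "Suc (b + (D - Suc r)) mod D \<noteq> 0" by simp
  then show ?thesis by (simp add: block_def div_Suc)
qed

text \<open>After adding a common offset, block and residue are quotient and remainder modulo
  \<open>D\<close>.\<close>

lemma block_residue_inj:
  assumes "a mod D = b mod D" "block a = block b" shows "a = b"
proof -
  have "(a + (D - Suc r)) mod D = (b + (D - Suc r)) mod D"
    using assms(1) by (rule mod_add_cong) simp
  then have "a + (D - Suc r) = b + (D - Suc r)"
    using assms(2) unfolding block_def by (metis div_mult_mod_eq)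
  then show ?thesis by simp
qed

lemma image_block_shift:
  assumes "\<And>b. b \<in> B \<Longrightarrow> b mod D \<noteq> r"
  shows "map_prod (index_colour (block_colour k)) (index_colour (block_colour k)) ` shift_rel B =
    (\<lambda>b. (block_colour k b, block_colour k b)) ` B"
  unfolding image_shift using assms by (intro image_cong) (auto simp: block_colour_def block_Suc)

text \<open>Shifts outside class \<open>r\<close> stay inside a block, so they too become part of
  the identity.\<close>

lemma block_colour: "index_colour (block_colour k) \<in> colourings"
proof (rule colouringsI)
  show "index_colour (block_colour k) x < 2" for x
    by (rule index_colour_less) (simp add: block_colour_def)
  show "pinj (map_prod (index_colour (block_colour k)) (index_colour (block_colour k)) ` ident_rel)"
    by (intro pinj_Id image_ident)
  show "pinj (map_prod (index_colour (block_colour k)) (index_colour (block_colour k)) ` shift_rel B)"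
    if "\<And>b. b \<in> B \<Longrightarrow> b mod D \<noteq> r" for B
    using that by (intro pinj_Id) (auto simp: image_block_shift)
qed

section \<open>Separating points, edges and paths\<close>

lemma separate_index:
  assumes "\<And>s. index_colour s \<in> colourings \<Longrightarrow> s a = s b" shows "a = b"
proof (rule block_residue_inj)
  show "a mod D = b mod D"
    using assms[OF residue_colour[of "b mod D"]] by (simp add: residue_colour_def split: if_splits)
  show "block a = block b"
    using assms[OF block_colour[of "block b"]] by (auto simp: block_colour_def split: if_splits)
qed

lemma separate_level:
  assumes "\<And>h. h \<in> colourings \<Longrightarrow> h \<alpha> = h \<beta>" shows "level \<alpha> = level \<beta>"
proof (rule antisym)
  show "level \<alpha> \<le> level \<beta>"
    using assms[OF level_colour[of "level \<alpha>"]] by (simp add: level_colour_def split: if_splits)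
  show "level \<beta> \<le> level \<alpha>"
    using assms[OF level_colour[of "level \<beta>"]] by (simp add: level_colour_def split: if_splits)
qed

lemma separate_point:
  assumes eq: "\<And>h. h \<in> colourings \<Longrightarrow> h \<alpha> = h \<beta>" shows "\<alpha> = \<beta>"
proof -
  have "level \<alpha> = level \<beta>" using eq by (rule separate_level)
  moreover have "a = b" if "\<alpha> = Lft a \<and> \<beta> = Lft b \<or> \<alpha> = Rgt a \<and> \<beta> = Rgt b" for a b
  proof (rule separate_index)
    show "s a = s b" if "index_colour s \<in> colourings" for s
      using eq[OF that] \<open>\<alpha> = Lft a \<and> \<beta> = Lft b \<or> \<alpha> = Rgt a \<and> \<beta> = Rgt b\<close> by auto
  qed
  ultimately show ?thesis by (cases \<alpha>; cases \<beta>) auto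
qed

text \<open>The preimage edge may vary with the colouring, but its levels do not; the thresholds
  \<open>k\<close> then determine the levels of \<alpha> and \<beta>.\<close>

lemma level_of_image:
  assumes "\<And>h. h \<in> colourings \<Longrightarrow> (h \<alpha>, h \<beta>) \<in> map_prod h h ` R"
    and "\<And>x y. (x, y) \<in> R \<Longrightarrow> level x = 1 \<and> level y = 2"
  shows "level \<alpha> = 1" "level \<beta> = 2"
proof -
  have *: "(k \<le> level \<alpha> \<longleftrightarrow> k \<le> 1) \<and> (k \<le> level \<beta> \<longleftrightarrow> k \<le> 2)" for k
  proof -
    obtain x y where xy: "(x, y) \<in> R" "level_colour k \<alpha> = level_colour k x"
      "level_colour k \<beta> = level_colour k y"
      using assms(1)[OF level_colour[of k]] by auto
    moreover from xy(1) have "level x = 1" "level y = 2"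
      using assms(2) by blast+
    ultimately show ?thesis
      by (simp add: level_colour_eq_iff)
  qed
  show "level \<alpha> = 1"
    using *[of "level \<alpha>"] *[of 1] by linarith
  show "level \<beta> = 2"
    using *[of "level \<beta>"] *[of 2] by linarith
qed

lemma separate_edge:
  assumes R: "R \<in> \<R>" "R = ident_rel \<or> (\<exists>B. R = shift_rel B)"
    and image: "\<And>h. h \<in> colourings \<Longrightarrow> (h \<alpha>, h \<beta>) \<in> map_prod h h ` R"
  shows "(\<alpha>, \<beta>) \<in> R"
proof -
  have levels: "level x = 1 \<and> level y = 2" if "(x, y) \<in> R" for x y
    using R(2) that by (auto simp: ident_rel_def shift_rel_def)
  have "level \<alpha> = 1" "level \<beta> = 2"
    using level_of_image[OF image levels] by auto
  then obtain a b where ab: "\<alpha> = Lft a" "\<beta> = Rgt b"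
    by (cases \<alpha>; cases \<beta>) auto
  have index: "(s a, s b) \<in> map_prod (index_colour s) (index_colour s) ` R"
    if "index_colour s \<in> colourings" for s
    using image[OF that] by (simp add: ab)
  show ?thesis
    using R(2)
  proof (elim disjE exE)
    assume "R = ident_rel"
    have "a = b"
    proof (rule separate_index)
      show "s a = s b" if "index_colour s \<in> colourings" for s
        using subsetD[OF image_ident index[OF that, unfolded \<open>R = ident_rel\<close>]] by simp
    qed
    then show ?thesis using \<open>R = ident_rel\<close> by (simp add: ab ident_rel_def)
  next
    fix B assume B: "R = shift_rel B"
    have avoid_B: "b' mod D \<noteq> r" if "b' \<in> B" for b'
      using avoid[of B b'] R(1) B that by simp
    have same: "b' mod D = b'' mod D" if "b' \<in> B" "b'' \<in> B" for b' b''
      using shift_rel_gadgetD[of B D b' b''] sub_gadget R(1) B that by blast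
    have residue: "(residue_colour m a, residue_colour m b) \<in>
        (\<lambda>b'. (residue_colour m (Suc b'), residue_colour m b')) ` B" for m
      using index[OF residue_colour] by (simp add: B image_shift)
    have blk: "(block_colour k a, block_colour k b) \<in> (\<lambda>b'. (block_colour k b', block_colour k b')) ` B" for k
      using index[OF block_colour] by (simp add: B image_block_shift[OF avoid_B])
    obtain b0 where b0: "b0 \<in> B" "b mod D = b0 mod D"
      using residue[of "b mod D"] by (auto simp: residue_colour_def split: if_splits)
    obtain b1 where b1: "b1 \<in> B" "a mod D = Suc b1 mod D"
      using residue[of "a mod D"] by (auto simp: residue_colour_def split: if_splits)
    have a_b: "a mod D = Suc b mod D"
      using b0 b1 same[of b0 b1] by (metis mod_Suc_eq)
    have "block (Suc b) = block b"
      using avoid_B[OF b0(1)] b0(2) by (intro block_Suc) simp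
    moreover have "block a = block b"
      using blk[of "block a"] by (auto simp: block_colour_def split: if_splits)
    ultimately have "a = Suc b"
      by (metis block_residue_inj[OF a_b])
    \<comment> \<open>It remains to see that \<open>b\<close> itself is in \<open>B\<close>: some
      member shares its block, and all members share its residue.\<close>
    obtain b2 where b2: "b2 \<in> B" "block b2 = block b"
      using blk[of "block b"] by (auto simp: block_colour_def split: if_splits)
    have "b2 = b"
      using same[OF b2(1) b0(1)] b0(2) b2(2) by (metis block_residue_inj)
    then show ?thesis
      using \<open>a = Suc b\<close> b2 by (simp add: ab B shift_rel_def)
  qed
qed

end

text \<open>A singleton letter fixes its end points, and induction continues. Any other letter is
  followed by at most one letter, a singleton, so a single appeal to \<open>separate_edge\<close>
  suffices.\<close>

lemma (in gadget_part) separate_run: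
  assumes \<phi>: "\<And>x. \<phi> x \<in> \<R>"
    and "\<And>h. h \<in> colourings \<Longrightarrow> (h \<alpha>, h \<beta>) \<in> run (\<lambda>x. map_prod h h ` \<phi> x) w"
  shows "(\<alpha>, \<beta>) \<in> run \<phi> w"
  using assms(2)
proof (induction w arbitrary: \<alpha>)
  case Nil
  then have "\<alpha> = \<beta>" by (intro separate_point) simp
  then show ?case by simp
next
  case (Cons x w)
  have gadget: "\<phi> y \<in> gadget D" for y
    using \<phi> sub_gadget by blast
  show ?case
  proof (cases "\<exists>e. \<phi> x = {e}")
    case True
    then obtain \<gamma> \<delta> where e: "\<phi> x = {(\<gamma>, \<delta>)}" by auto
    have eq: "h \<alpha> = h \<gamma> \<and> (h \<delta>, h \<beta>) \<in> run (\<lambda>x. map_prod h h ` \<phi> x) w" if "h \<in> colourings" for h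
      using Cons.prems[OF that] by (auto simp: e)
    then have "\<alpha> = \<gamma>" by (intro separate_point) simp
    moreover have "(\<delta>, \<beta>) \<in> run \<phi> w" using eq by (intro Cons.IH) simp
    ultimately show ?thesis by (auto simp: e)
  next
    case not_single: False
    have kind: "\<phi> x = ident_rel \<or> (\<exists>B. \<phi> x = shift_rel B)"
      using gadget[of x] by (cases rule: gadget_cases) (use not_single in auto)
    show ?thesis
    proof (cases w)
      case Nil
      have "(h \<alpha>, h \<beta>) \<in> map_prod h h ` \<phi> x" if "h \<in> colourings" for h
        using Cons.prems[OF that] by (simp add: Nil)
      then have "(\<alpha>, \<beta>) \<in> \<phi> x" using separate_edge[OF \<phi> kind] by blast
      then show ?thesis by (simp add: Nil)
    next
      case w: (Cons y w')
      have step: "\<exists>\<gamma> \<gamma>' \<delta> \<epsilon>. (\<gamma>, \<gamma>') \<in> \<phi> x \<and> (\<delta>, \<epsilon>) \<in> \<phi> y \<and> h \<alpha> = h \<gamma> \<and> h \<gamma>' = h \<delta> \<and>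
          (h \<epsilon>, h \<beta>) \<in> run (\<lambda>x. map_prod h h ` \<phi> x) w'" if "h \<in> colourings" for h
        using Cons.prems[OF that] by (simp add: w) fast
      obtain \<gamma> \<gamma>' \<delta> \<epsilon> where "(\<gamma>, \<gamma>') \<in> \<phi> x" and y: "(\<delta>, \<epsilon>) \<in> \<phi> y"
        and "level_colour 2 \<gamma>' = level_colour 2 \<delta>"
        using step[OF level_colour] by blast
      \<comment> \<open>A letter that is not a singleton ends on level 2, and the colour with
        threshold 2 transfers this bound to \<delta>.\<close>
      then have "2 \<le> level \<delta>"
        using gadget_levels[OF gadget not_single] by (metis level_colour_eq_iff order_refl)
      then have single: "\<exists>e. \<phi> y = {e}"
        using gadget_levels[OF gadget _ y] by fastforce
      then have y_eq: "\<phi> y = {(\<delta>, \<epsilon>)}" using y by auto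
      have "level \<epsilon> = 3"
        using level_less_gadget[OF gadget y] \<open>2 \<le> level \<delta>\<close> level_le_3[of \<epsilon>] by simp
      \<comment> \<open>A further letter would have to start on level 3, the top level.\<close>
      have w': "w' = []"
      proof (cases w')
        case (Cons z w'')
        obtain \<zeta> \<eta> where z: "(\<zeta>, \<eta>) \<in> \<phi> z" "level_colour 3 \<epsilon> = level_colour 3 \<zeta>"
          using step[OF level_colour[of 3]] by (auto simp: y_eq Cons)
        then have "3 \<le> level \<zeta>"
          using \<open>level \<epsilon> = 3\<close> by (simp add: level_colour_eq_iff)
        then show ?thesis
          using level_less_gadget[OF gadget z(1)] level_le_3[of \<eta>] by simp
      qed
      have "(h \<alpha>, h \<delta>) \<in> map_prod h h ` \<phi> x \<and> h \<epsilon> = h \<beta>" if h: "h \<in> colourings" for h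
      proof -
        obtain \<zeta> \<zeta>' where "(\<zeta>, \<zeta>') \<in> \<phi> x" "h \<alpha> = h \<zeta>" "h \<zeta>' = h \<delta>" "h \<epsilon> = h \<beta>"
          using step[OF h] by (auto simp: y_eq w')
        then show ?thesis by (metis map_prod_imageI)
      qed
      then have "(\<alpha>, \<delta>) \<in> \<phi> x" "\<epsilon> = \<beta>"
        using separate_edge[OF \<phi> kind] separate_point by blast+
      then show ?thesis by (auto simp: w w' y_eq)
    qed
  qed
qed

lemma run_image: "(\<alpha>, \<beta>) \<in> run \<phi> w \<Longrightarrow> (h \<alpha>, h \<beta>) \<in> run (\<lambda>x. map_prod h h ` \<phi> x) w"
proof (induction w arbitrary: \<alpha>)
  case (Cons x w)
  then obtain \<gamma> where "(\<alpha>, \<gamma>) \<in> \<phi> x" "(\<gamma>, \<beta>) \<in> run \<phi> w" by auto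
  then show ?case
    using Cons.IH[of \<gamma>] map_prod_imageI[of \<alpha> \<gamma> "\<phi> x" h h] by auto
qed simp

text \<open>Every colouring pushes a pair in the value of \<open>u\<close> down to
  \<open>finite_pinj t\<close>, where the identity applies; \<open>separate_run\<close> lifts the
  words of \<open>v\<close> back.\<close>

lemma (in gadget_part) eval_gadget_mono:
  assumes "holds_in (rel_alg (finite_pinj t)) (u, v)" "2 \<le> t" "\<And>x. \<phi> x \<in> \<R>"
  shows "eval_term (rel_alg C) \<phi> u \<subseteq> eval_term (rel_alg C) \<phi> v"
proof (rule subrelI)
  fix \<alpha> \<beta> assume u: "(\<alpha>, \<beta>) \<in> eval_term (rel_alg C) \<phi> u"
  have pinj: "pinj (\<phi> x)" for x
    using assms(3) sub_gadget pinj_gadget by blast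
  have "(\<alpha>, \<beta>) \<in> run \<phi> w" if "w \<in> words v" for w
  proof (rule separate_run[OF assms(3)])
    fix h assume h: "h \<in> colourings"
    let ?\<psi> = "\<lambda>x. map_prod h h ` \<phi> x"
    have \<psi>: "pinj (?\<psi> x)" "?\<psi> x \<in> finite_pinj t" for x
      using h assms(2,3) by (auto simp: colourings_def finite_pinj_def intro: order.strict_trans2)
    have "(h \<alpha>, h \<beta>) \<in> eval_term (rel_alg (finite_pinj t)) ?\<psi> u"
      using u run_image[of \<alpha> \<beta> \<phi> _ h] by (simp add: eval_term_rel \<psi> pinj)
    then have "(h \<alpha>, h \<beta>) \<in> eval_term (rel_alg (finite_pinj t)) ?\<psi> v"
      using assms(1) \<psi>(2) by (simp add: holds_in_def)
    then show "(h \<alpha>, h \<beta>) \<in> run ?\<psi> w"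
      using that by (simp add: eval_term_rel \<psi>)
  qed
  then show "(\<alpha>, \<beta>) \<in> eval_term (rel_alg C) \<phi> v"
    by (simp add: eval_term_rel pinj)
qed

lemma holds_in_gadget:
  assumes holds: "holds_in (rel_alg (finite_pinj t)) (u, v)" and t: "2 \<le> t"
    and few: "card (vars u \<union> vars v) < D"
  shows "holds_in (rel_alg (gadget D)) (u, v)"
  unfolding holds_in_def
proof (intro allI impI)
  fix \<phi> :: "nat \<Rightarrow> point rel" assume "\<forall>x. \<phi> x \<in> carrier (rel_alg (gadget D))"
  then have \<phi>: "\<phi> x \<in> gadget D" for x by simp
  let ?V = "vars u \<union> vars v"
  \<comment> \<open>The residue class of the shifts in \<open>\<phi> x\<close>. If there are none
    the value is arbitrary, but still only one class is used up.\<close>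
  define g where "g x = (SOME b. (Lft (Suc b), Rgt b) \<in> \<phi> x) mod D" for x
  \<comment> \<open>Variables outside the identity are sent to the empty relation, so that they
    contribute no shifts to the range.\<close>
  let ?\<psi> = "\<lambda>x. if x \<in> ?V then \<phi> x else {}"
  have "card (g ` ?V) < card {..<D}"
    using few card_image_le[of ?V g] by (simp add: finite_vars)
  moreover have "finite (g ` ?V)" by (simp add: finite_vars)
  ultimately have "\<not> {..<D} \<subseteq> g ` ?V" by (meson card_mono not_less)
  then obtain r where r: "r < D" "r \<notin> g ` ?V" by blast
  interpret gadget_part D r "range ?\<psi>"
  proof
    show "r < D" by (rule r)
    show "range ?\<psi> \<subseteq> gadget D" using \<phi> gadget_empty by auto
    fix B b assume B: "shift_rel B \<in> range ?\<psi>" "b \<in> B"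
    then obtain x where "shift_rel B = ?\<psi> x" by blast
    moreover have "shift_rel B \<noteq> {}" using B(2) by (auto simp: shift_rel_def)
    ultimately have x: "x \<in> ?V" "\<phi> x = shift_rel B" by (auto split: if_splits)
    let ?b = "SOME b. (Lft (Suc b), Rgt b) \<in> \<phi> x"
    have "(Lft (Suc ?b), Rgt ?b) \<in> \<phi> x"
      by (rule someI[of _ b]) (simp add: x B)
    then have "?b \<in> B" by (simp add: x)
    then have "g x = b mod D"
      unfolding g_def using shift_rel_gadgetD[of B D ?b b] \<phi>[of x] B(2) x(2) by metis
    then show "b mod D \<noteq> r" using r(2) imageI[OF x(1), of g] by metis
  qed
  have sym: "holds_in (rel_alg (finite_pinj t)) (v, u)"
    using holds by (simp add: holds_in_def)
  have "eval_term (rel_alg (gadget D)) ?\<psi> u = eval_term (rel_alg (gadget D)) ?\<psi> v"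
    using eval_gadget_mono[OF holds t, of ?\<psi>] eval_gadget_mono[OF sym t, of ?\<psi>] by blast
  moreover have "eval_term (rel_alg (gadget D)) ?\<psi> w = eval_term (rel_alg (gadget D)) \<phi> w"
    if "w = u \<or> w = v" for w
    using that by (intro eval_term_cong) auto
  ultimately show "eval_term (rel_alg (gadget D)) \<phi> (fst (u, v)) =
      eval_term (rel_alg (gadget D)) \<phi> (snd (u, v))"
    by simp
qed

section \<open>Identities with many variables\<close>

primrec sum_terms :: "sterm \<Rightarrow> sterm list \<Rightarrow> sterm" where
  "sum_terms u [] = u"
| "sum_terms u (v # vs) = sum_terms (Add u v) vs"

text \<open>Variable \<open>3 * i\<close> is \<open>x\<^sub>i\<close> and \<open>3 * j + 1\<close>
  is \<open>z\<^sub>j\<close>. Variable 2 is \<open>y\<close>, and \<open>3 * Suc k + 2\<close> is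
  \<open>y\<^sub>k\<close>.\<close>

definition edge :: "nat \<Rightarrow> nat \<Rightarrow> nat \<Rightarrow> sterm" where
  "edge i k j = Mul (Mul (Var (3 * i)) (Var (3 * k + 2))) (Var (3 * j + 1))"

definition chain :: "nat \<Rightarrow> nat \<Rightarrow> sterm" where
  "chain D n = sum_terms (edge 0 0 0)
     (map (\<lambda>j. edge j 0 j) [0..<Suc n] @ map (\<lambda>j. edge (Suc j) (Suc (j mod D)) j) [0..<n])"

lemma eval_sum_terms:
  "e \<in> eval_term (rel_alg C) \<phi> (sum_terms u vs) \<longleftrightarrow>
     e \<in> eval_term (rel_alg C) \<phi> u \<and> (\<forall>v\<in>set vs. e \<in> eval_term (rel_alg C) \<phi> v)"
  by (induction vs arbitrary: u) auto

lemma eval_chain: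
  "e \<in> eval_term (rel_alg C) \<phi> (chain D n) \<longleftrightarrow>
     (\<forall>j\<le>n. e \<in> eval_term (rel_alg C) \<phi> (edge j 0 j)) \<and>
     (\<forall>j<n. e \<in> eval_term (rel_alg C) \<phi> (edge (Suc j) (Suc (j mod D)) j))"
  by (auto simp: chain_def eval_sum_terms less_Suc_eq_le simp del: upt_Suc)

lemma eval_edge:
  "(p, q) \<in> eval_term (rel_alg C) \<phi> (edge i k j) \<longleftrightarrow>
     (\<exists>a b. (p, a) \<in> \<phi> (3 * i) \<and> (a, b) \<in> \<phi> (3 * k + 2) \<and> (b, q) \<in> \<phi> (3 * j + 1))"
  by (auto simp: edge_def)

text \<open>The period depends on the sequence, but \<open>fact t\<close> is a multiple of every
  possible \<open>d\<close>, so one \<open>n\<close> serves all valuations.\<close>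

lemma pigeonhole_period:
  fixes s :: "nat \<Rightarrow> nat"
  assumes bound: "\<And>j. j \<le> n \<Longrightarrow> s j < t" and n: "n = (t + fact t) * D"
    and step: "\<And>i j. i < n \<Longrightarrow> j < n \<Longrightarrow> i mod D = j mod D \<Longrightarrow> s i = s j \<Longrightarrow> s (Suc i) = s (Suc j)"
  shows "s (t * D) = s n"
proof -
  have "\<not> inj_on (\<lambda>k. s (k * D)) {..t}"
  proof
    assume "inj_on (\<lambda>k. s (k * D)) {..t}"
    moreover have "(\<lambda>k. s (k * D)) ` {..t} \<subseteq> {..<t}"
      using bound n by auto
    ultimately have "card {..t} \<le> card {..<t}" by (intro card_inj_on_le) auto
    then show False by simp
  qed
  then obtain k l where kl: "k < l" "l \<le> t" "s (k * D) = s (l * D)"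
    unfolding inj_on_def by (metis atMost_iff linorder_neqE_nat)
  have shift: "s (k * D + e) = s (l * D + e)" if "l * D + e \<le> n" for e
    using that
  proof (induction e)
    case (Suc e)
    have "k * D + e < n"
      using kl(1) Suc.prems mult_le_mono1[of k l D] by linarith
    then show ?case
      using Suc step[of "k * D + e" "l * D + e"] by simp
  qed (simp add: kl(3))
  define d where "d = l - k"
  have period: "s j = s (j + d * D)" if "k * D \<le> j" "j + d * D \<le> n" for j
  proof -
    have "l * D = k * D + d * D" using kl(1) by (simp add: d_def flip: add_mult_distrib)
    then show ?thesis
      using shift[of "j - k * D"] that by (simp add: algebra_simps)
  qed
  have iterate: "s (t * D) = s (t * D + m * (d * D))" if "m * d \<le> fact t" for m
    using that
  proof (induction m)
    case (Suc m)
    have "(m * d + d) * D \<le> fact t * D" using Suc.prems by (intro mult_le_mono1) simp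
    then have "t * D + m * (d * D) + d * D \<le> n" by (simp add: n algebra_simps)
    moreover have "k * D \<le> t * D + m * (d * D)" using kl by (simp add: trans_le_add1)
    ultimately show ?case
      using Suc period[of "t * D + m * (d * D)"] by (simp add: algebra_simps)
  qed simp
  have "d dvd fact t" using kl by (intro dvd_fact) (auto simp: d_def)
  then obtain m where "fact t = d * m" by blast
  then show ?thesis using iterate[of m] by (simp add: n algebra_simps)
qed

lemma chain_holds:
  assumes n: "n = (t + fact t) * D"
  shows "holds_in (rel_alg (finite_pinj t)) (chain D n, Add (chain D n) (edge (t * D) 0 n))"
  unfolding holds_in_def
proof (intro allI impI)
  fix \<phi> :: "nat \<Rightarrow> nat rel" assume "\<forall>x. \<phi> x \<in> carrier (rel_alg (finite_pinj t))"
  then have \<phi>: "\<phi> x \<subseteq> {..<t} \<times> {..<t}" "pinj (\<phi> x)" for x by (auto simp: finite_pinj_def)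
  let ?eval = "eval_term (rel_alg (finite_pinj t)) \<phi>"
  have "(p, q) \<in> ?eval (edge (t * D) 0 n)" if pq: "(p, q) \<in> ?eval (chain D n)" for p q
  proof -
    have "\<exists>a b. (p, a) \<in> \<phi> (3 * j) \<and> (a, b) \<in> \<phi> (3 * 0 + 2) \<and> (b, q) \<in> \<phi> (3 * j + 1)" if "j \<le> n" for j
      using pq that unfolding eval_chain eval_edge by blast
    \<comment> \<open>\<open>s j\<close> is the point after \<open>x\<^sub>j\<close>, and
      \<open>r j\<close> the point before \<open>z\<^sub>j\<close>.\<close>
    then obtain s r where
      sr: "\<And>j. j \<le> n \<Longrightarrow> (p, s j) \<in> \<phi> (3 * j) \<and> (s j, r j) \<in> \<phi> (3 * 0 + 2) \<and> (r j, q) \<in> \<phi> (3 * j + 1)"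
      by metis
    have link: "(s (Suc j), r j) \<in> \<phi> (3 * Suc (j mod D) + 2)" if "j < n" for j
    proof -
      have "(p, q) \<in> ?eval (edge (Suc j) (Suc (j mod D)) j)"
        using pq that by (simp add: eval_chain)
      then obtain a b where ab: "(p, a) \<in> \<phi> (3 * Suc j)" "(a, b) \<in> \<phi> (3 * Suc (j mod D) + 2)"
        "(b, q) \<in> \<phi> (3 * j + 1)"
        unfolding eval_edge by blast
      have "a = s (Suc j)"
        by (rule pinj_right[OF \<phi>(2) ab(1)]) (use sr[of "Suc j"] that in auto)
      moreover have "b = r j"
        by (rule pinj_left[OF \<phi>(2) ab(3)]) (use sr[of j] that in auto)
      ultimately show ?thesis using ab(2) by simp
    qed
    have r_cong: "r i = r j" if "i \<le> n" "j \<le> n" "s i = s j" for i j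
      by (rule pinj_right[OF \<phi>(2)[of "3 * 0 + 2"], of "s i"]) (use sr that in metis)+
    have "s (t * D) = s n"
    proof (rule pigeonhole_period[OF _ n])
      show "s j < t" if "j \<le> n" for j using sr[OF that] \<phi>(1) by blast
      show "s (Suc i) = s (Suc j)" if "i < n" "j < n" "i mod D = j mod D" "s i = s j" for i j
      proof -
        have "r i = r j" using that by (intro r_cong) simp_all
        then have "(s (Suc j), r i) \<in> \<phi> (3 * Suc (i mod D) + 2)"
          using link[OF that(2)] that(3) by simp
        then show ?thesis
          using pinj_left[OF \<phi>(2) link[OF that(1)]] by blast
      qed
    qed
    moreover have "t * D \<le> n" by (simp add: n)
    \<comment> \<open>The word goes from \<open>p\<close> to \<open>s (t * D) = s n\<close>, and
      from there through \<open>r n\<close> to \<open>q\<close>.\<close>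
    ultimately show ?thesis
      using sr[of "t * D"] sr[of n] unfolding eval_edge by (metis order_refl)
  qed
  then show "?eval (fst (chain D n, Add (chain D n) (edge (t * D) 0 n))) =
      ?eval (snd (chain D n, Add (chain D n) (edge (t * D) 0 n)))"
    by auto
qed

text \<open>From \<open>Lft m\<close> the letter \<open>y\<close> leads only to
  \<open>Rgt m\<close>, whereas \<open>z\<^sub>n\<close> starts at \<open>Rgt n\<close>.\<close>

lemma chain_fails:
  assumes "m \<noteq> n"
  shows "\<not> holds_in (rel_alg (gadget D)) (chain D n, Add (chain D n) (edge m 0 n))"
proof
  define \<phi> where "\<phi> x =
    (if x mod 3 = 0 then {(Src, Lft (x div 3))} else if x mod 3 = 1 then {(Rgt (x div 3), Tgt)}
     else if x div 3 = 0 then ident_rel else shift_rel {b. b mod D = x div 3 - 1})" for x :: nat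
  have \<phi>: "\<phi> (3 * i) = {(Src, Lft i)}" "\<phi> (3 * i + 1) = {(Rgt i, Tgt)}" "\<phi> (3 * 0 + 2) = ident_rel"
    "\<phi> (3 * Suc i + 2) = shift_rel {b. b mod D = i}" for i
    by (simp_all add: \<phi>_def)
  have carrier: "\<phi> x \<in> gadget D" for x
    unfolding \<phi>_def by (auto intro: gadget_single gadget_ident gadget_shift)
  have "(Src, Tgt) \<in> eval_term (rel_alg (gadget D)) \<phi> (chain D n)"
    unfolding eval_chain eval_edge \<phi> by (auto simp: ident_rel_def)
  moreover have "(Src, Tgt) \<notin> eval_term (rel_alg (gadget D)) \<phi> (edge m 0 n)"
    unfolding eval_edge \<phi> using assms by (auto simp: ident_rel_def)
  moreover assume "holds_in (rel_alg (gadget D)) (chain D n, Add (chain D n) (edge m 0 n))"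
  ultimately show False
    using carrier by (auto simp: holds_in_def)
qed

section \<open>Soundness of equational logic and the conclusion\<close>

lemma eval_subst_term:
  "eval_term S \<phi> (subst_term \<sigma> u) = eval_term S (\<lambda>x. eval_term S \<phi> (\<sigma> x)) u"
  by (induction u) auto

lemma follows_sound:
  assumes "follows \<Sigma> u v" "\<And>e. e \<in> \<Sigma> \<Longrightarrow> holds_in S e"
    and closed: "\<And>x y. x \<in> carrier S \<Longrightarrow> y \<in> carrier S \<Longrightarrow> alg_add S x y \<in> carrier S \<and> alg_mul S x y \<in> carrier S"
  shows "holds_in S (u, v)"
  using assms(1)
proof (induction rule: follows.induct)
  case (inst u v \<sigma>)
  have "eval_term S \<phi> w \<in> carrier S" if "\<forall>x. \<phi> x \<in> carrier S" for \<phi> w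
    using that closed by (induction w) auto
  then show ?case
    using assms(2)[OF inst] by (simp add: holds_in_def eval_subst_term)
qed (simp_all add: holds_in_def)

lemma not_finitely_based:
  assumes "2 \<le> t" "finite \<Sigma>"
  shows "\<not> identity_basis (rel_alg (finite_pinj t)) \<Sigma>"
proof
  assume basis: "identity_basis (rel_alg (finite_pinj t)) \<Sigma>"
  \<comment> \<open>\<open>D\<close> exceeds the number of variables of each identity in \<Sigma>.
    Being positive, it also makes \<open>t * D\<close> differ from \<open>n\<close>.\<close>
  define D where "D = Suc (\<Sum>(u, v)\<in>\<Sigma>. card (vars u \<union> vars v))"
  define n where "n = (t + fact t) * D"
  have "holds_in (rel_alg (gadget D)) e" if "e \<in> \<Sigma>" for e
  proof -
    obtain u v where e: "e = (u, v)" by (cases e)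
    have "card (vars u \<union> vars v) < D"
      using member_le_sum[of e \<Sigma> "\<lambda>(u, v). card (vars u \<union> vars v)"] that assms(2)
      by (simp add: D_def e)
    then show ?thesis
      using basis that assms(1) unfolding e identity_basis_def by (intro holds_in_gadget) auto
  qed
  moreover have follows: "follows \<Sigma> (chain D n) (Add (chain D n) (edge (t * D) 0 n))"
    using basis chain_holds[OF n_def] by (simp add: identity_basis_def)
  ultimately have "holds_in (rel_alg (gadget D)) (chain D n, Add (chain D n) (edge (t * D) 0 n))"
    by (intro follows_sound[OF follows]) (simp_all add: gadget_Int gadget_relcomp)
  moreover have "t * D \<noteq> n" by (simp add: n_def D_def add_mult_distrib)
  ultimately show False using chain_fails by blast
qed

theorem theorem1p3:
  fixes t :: nat
  assumes "t \<ge> 1"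
  shows "finitely_based (rook_semiring t) \<longleftrightarrow> t = 1"
proof
  assume "finitely_based (rook_semiring t)"
  then obtain \<Sigma> where "finite \<Sigma>" "identity_basis (rel_alg (finite_pinj t)) \<Sigma>"
    unfolding finitely_based_def identity_basis_def holds_in_rook by blast
  then have "\<not> 2 \<le> t" using not_finitely_based by blast
  then show "t = 1" using assms by simp
next
  assume "t = 1"
  then show "finitely_based (rook_semiring t)" using finitely_based_1 by simp
qed

end
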